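(* Let $\mathbb{A}$ be a commutative ring with unit, $\mathfrak{m}\subset\mathbb{A}$ an ideal, and $Q$ a rack with associated Yang-Baxter operator $c_Q\colon\mathbb{A}Q^2\to\mathbb{A}Q^2$, $x\otimes y\mapsto y\otimes(x\ast y)$. Let $c_Qf$ be an entropic deformation of $c_Q$, i.e. $f$ is an automorphism of $\mathbb{A}Q^2$ that is entropic with respect to $c_Q$ and satisfies $f\equiv\mathrm{II}$ modulo $\mathfrak{m}$. Let $\tau\colon\mathbb{A}Q^2\to\mathbb{A}Q^2$ be the transposition $x\otimes y\mapsto y\otimes x$. Then $c_Qf$ satisfies the Yang-Baxter equation if and only if $\tau f$ satisfies the Yang-Baxter equation, that is, if and only if $f$ is an r-matrix.
   Context: All tensor products are over $\mathbb{A}$; $\mathrm{I}$ is the identity of a module $V$ and $\mathrm{II}=\mathrm{I}\otimes\mathrm{I}$. A rack is a set $Q$ with a binary operation $(x,y)\mapsto x\ast y=x^y$ such that every right translation $\varrho(y)\colon x\mapsto x\ast y$ is a bijection of $Q$ and $(x\ast y)\ast z=(x\ast z)\ast(y\ast z)$ for all $x,y,z$. $V=\mathbb{A}Q$ is the free $\mathbb{A}$-module with basis $Q$; $\mathbb{A}Q^n$ is identified with $V^{\otimes n}$. The Yang-Baxter equation for $c\colon V\otimes V\to V\otimes V$ is $(c\otimes\mathrm{I})(\mathrm{I}\otimes c)(c\otimes\mathrm{I})=(\mathrm{I}\otimes c)(c\otimes\mathrm{I})(\mathrm{I}\otimes c)$. An r-matrix is an automorphism $f\colon V\otimes V\to V\otimes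 V$ satisfying $f_{12}f_{13}f_{23}=f_{23}f_{13}f_{12}$, with $f_{ij}$ acting on the $i$th and $j$th factors of $V\otimes V\otimes V$. An $\mathbb{A}$-linear map $f\colon\mathbb{A}Q^n\to\mathbb{A}Q^n$ is entropic with respect to $c_Q$ if for each $i=0,\dots,n$ one has, on $V^{\otimes(n+1)}$, $$(c_n\cdots c_{i+1})^{-1}(f\otimes\mathrm{I})(c_n\cdots c_{i+1})=(c_1\cdots c_i)^{-1}(\mathrm{I}\otimes f)(c_1\cdots c_i),$$ where $c_j=\mathrm{I}^{\otimes(j-1)}\otimes c_Q\otimes\mathrm{I}^{\otimes(n-j)}$ and products are compositions of maps (rightmost applied first). *)

theory Defs
  imports Complex_Main "HOL-Library.Poly_Mapping"
begin

text \<open>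
  The direct sum of all tensor powers of the free module on \<open>'q\<close> is \<open>'q list \<Rightarrow>\<^sub>0 'a\<close>: a word
  \<open>[x\<^sub>1, \<dots>, x\<^sub>n]\<close> stands for \<open>x\<^sub>1 \<otimes> \<dots> \<otimes> x\<^sub>n\<close>. For a rack with carrier \<open>Q\<close>, the \<open>n\<close>-th
  tensor power of the free module on \<open>Q\<close> is the submodule \<open>tpow Q n\<close>. Maps are
  HOL functions on the ambient type, of which only the values on the relevant \<open>tpow Q n\<close> matter.
\<close>

locale rack =
  fixes Q :: "'q set" and op :: "'q \<Rightarrow> 'q \<Rightarrow> 'q"
  assumes translation_bij: "y \<in> Q \<Longrightarrow> bij_betw (\<lambda>x. op x y) Q Q"
    and self_distrib:
      "\<lbrakk>x \<in> Q; y \<in> Q; z \<in> Q\<rbrakk> \<Longrightarrow> op (op x y) z = op (op x z) (op y z)"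

definition tpow :: "'q set \<Rightarrow> nat \<Rightarrow> ('q list \<Rightarrow>\<^sub>0 'a::comm_ring_1) set" where
  "tpow Q n = {v. Poly_Mapping.keys v \<subseteq> {w. length w = n \<and> set w \<subseteq> Q}}"

definition smult :: "'a::comm_ring_1 \<Rightarrow> ('b \<Rightarrow>\<^sub>0 'a) \<Rightarrow> ('b \<Rightarrow>\<^sub>0 'a)" where
  "smult a v = Poly_Mapping.map ((*) a) v"

definition basis :: "'b \<Rightarrow> ('b \<Rightarrow>\<^sub>0 'a::comm_ring_1)" where
  "basis w = Poly_Mapping.single w 1"

definition lin_ext :: "('b \<Rightarrow> ('c \<Rightarrow>\<^sub>0 'a::comm_ring_1)) \<Rightarrow> ('b \<Rightarrow>\<^sub>0 'a) \<Rightarrow> ('c \<Rightarrow>\<^sub>0 'a)" where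
  "lin_ext g v = (\<Sum>w\<in>Poly_Mapping.keys v. smult (Poly_Mapping.lookup v w) (g w))"

definition linear_on :: "('b \<Rightarrow>\<^sub>0 'a::comm_ring_1) set \<Rightarrow> (('b \<Rightarrow>\<^sub>0 'a) \<Rightarrow> ('c \<Rightarrow>\<^sub>0 'a)) \<Rightarrow> bool" where
  "linear_on M f \<longleftrightarrow>
     (\<forall>u\<in>M. \<forall>v\<in>M. f (u + v) = f u + f v) \<and> (\<forall>a. \<forall>v\<in>M. f (smult a v) = smult a (f v))"

definition automorphism_on :: "('b \<Rightarrow>\<^sub>0 'a::comm_ring_1) set \<Rightarrow> (('b \<Rightarrow>\<^sub>0 'a) \<Rightarrow> ('b \<Rightarrow>\<^sub>0 'a)) \<Rightarrow> bool" where
  "automorphism_on M f \<longleftrightarrow> linear_on M f \<and> bij_betw f M M"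

definition tens :: "('q list \<Rightarrow>\<^sub>0 'a::comm_ring_1) \<Rightarrow> ('q list \<Rightarrow>\<^sub>0 'a) \<Rightarrow> ('q list \<Rightarrow>\<^sub>0 'a)" where
  "tens u v = lin_ext (\<lambda>x. lin_ext (\<lambda>y. basis (x @ y)) v) u"

text \<open>\<open>tmap m f g\<close> is the tensor product of maps \<open>f \<otimes> g\<close>, where \<open>f\<close> acts on the first \<open>m\<close>
  tensor factors and \<open>g\<close> on all remaining ones.\<close>

definition tmap ::
  "nat \<Rightarrow> (('q list \<Rightarrow>\<^sub>0 'a::comm_ring_1) \<Rightarrow> ('q list \<Rightarrow>\<^sub>0 'a))
     \<Rightarrow> (('q list \<Rightarrow>\<^sub>0 'a) \<Rightarrow> ('q list \<Rightarrow>\<^sub>0 'a)) \<Rightarrow> ('q list \<Rightarrow>\<^sub>0 'a) \<Rightarrow> ('q list \<Rightarrow>\<^sub>0 'a)" where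
  "tmap m f g = lin_ext (\<lambda>w. tens (f (basis (take m w))) (g (basis (drop m w))))"

definition cQ :: "('q \<Rightarrow> 'q \<Rightarrow> 'q) \<Rightarrow> ('q list \<Rightarrow>\<^sub>0 'a::comm_ring_1) \<Rightarrow> ('q list \<Rightarrow>\<^sub>0 'a)" where
  "cQ op = lin_ext (\<lambda>w. basis [w ! 1, op (w ! 0) (w ! 1)])"

definition transposition :: "('q list \<Rightarrow>\<^sub>0 'a::comm_ring_1) \<Rightarrow> ('q list \<Rightarrow>\<^sub>0 'a)" where
  "transposition = lin_ext (\<lambda>w. basis [w ! 1, w ! 0])"

definition yang_baxter :: "'q set \<Rightarrow> (('q list \<Rightarrow>\<^sub>0 'a::comm_ring_1) \<Rightarrow> ('q list \<Rightarrow>\<^sub>0 'a)) \<Rightarrow> bool" where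
  "yang_baxter Q c \<longleftrightarrow>
     (\<forall>v\<in>tpow Q 3.
        (tmap 2 c id \<circ> tmap 1 id c \<circ> tmap 2 c id) v = (tmap 1 id c \<circ> tmap 2 c id \<circ> tmap 1 id c) v)"

text \<open>\<open>leg f i j\<close> is \<open>f\<^sub>i\<^sub>j\<close>, with tensor factors counted from 1 whereas list positions are
  counted from 0.\<close>

definition leg ::
  "(('q list \<Rightarrow>\<^sub>0 'a::comm_ring_1) \<Rightarrow> ('q list \<Rightarrow>\<^sub>0 'a)) \<Rightarrow> nat \<Rightarrow> nat
     \<Rightarrow> ('q list \<Rightarrow>\<^sub>0 'a) \<Rightarrow> ('q list \<Rightarrow>\<^sub>0 'a)" where
  "leg f i j = lin_ext (\<lambda>w. lin_ext (\<lambda>p. basis (w[i - 1 := p ! 0, j - 1 := p ! 1]))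
                              (f (basis [w ! (i - 1), w ! (j - 1)])))"

definition r_matrix :: "'q set \<Rightarrow> (('q list \<Rightarrow>\<^sub>0 'a::comm_ring_1) \<Rightarrow> ('q list \<Rightarrow>\<^sub>0 'a)) \<Rightarrow> bool" where
  "r_matrix Q f \<longleftrightarrow>
     automorphism_on (tpow Q 2) f \<and>
     (\<forall>v\<in>tpow Q 3.
        (leg f 1 2 \<circ> leg f 1 3 \<circ> leg f 2 3) v = (leg f 2 3 \<circ> leg f 1 3 \<circ> leg f 1 2) v)"

text \<open>\<open>braid_gen c j\<close> is \<open>c\<close> acting on the factors \<open>j\<close> and \<open>j + 1\<close>, uniformly in the total
  number of factors.\<close>

definition braid_gen ::
  "(('q list \<Rightarrow>\<^sub>0 'a::comm_ring_1) \<Rightarrow> ('q list \<Rightarrow>\<^sub>0 'a)) \<Rightarrow> nat \<Rightarrow> ('q list \<Rightarrow>\<^sub>0 'a) \<Rightarrow> ('q list \<Rightarrow>\<^sub>0 'a)" where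
  "braid_gen c j = tmap (j - 1) id (tmap 2 c id)"

definition comp_list :: "('b \<Rightarrow> 'b) list \<Rightarrow> 'b \<Rightarrow> 'b" where
  "comp_list hs = foldr (\<circ>) hs id"

definition entropic ::
  "'q set \<Rightarrow> (('q list \<Rightarrow>\<^sub>0 'a::comm_ring_1) \<Rightarrow> ('q list \<Rightarrow>\<^sub>0 'a)) \<Rightarrow> nat
     \<Rightarrow> (('q list \<Rightarrow>\<^sub>0 'a) \<Rightarrow> ('q list \<Rightarrow>\<^sub>0 'a)) \<Rightarrow> bool" where
  "entropic Q c n f \<longleftrightarrow>
     linear_on (tpow Q n) f \<and> f ` tpow Q n \<subseteq> tpow Q n \<and>
     (\<forall>i\<in>{0..n}.
        let L = comp_list (map (braid_gen c) (rev [i + 1..<n + 1]));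
            R = comp_list (map (braid_gen c) [1..<i + 1])
        in \<forall>v\<in>tpow Q (n + 1).
             inv_into (tpow Q (n + 1)) L (tmap n f id (L v)) =
             inv_into (tpow Q (n + 1)) R (tmap 1 id f (R v)))"

definition cong_id_mod ::
  "'a::comm_ring_1 set \<Rightarrow> ('b \<Rightarrow>\<^sub>0 'a) set \<Rightarrow> (('b \<Rightarrow>\<^sub>0 'a) \<Rightarrow> ('b \<Rightarrow>\<^sub>0 'a)) \<Rightarrow> bool" where
  "cong_id_mod \<mm> M f \<longleftrightarrow> (\<forall>v\<in>M. \<forall>w. Poly_Mapping.lookup (f v - v) w \<in> \<mm>)"

end

theory Submission
  imports Defs
begin

text \<open>
  Write \<open>c\<close> for \<open>cQ op\<close>, let \<open>c\<^sub>1, c\<^sub>2\<close> be \<open>c\<close> acting on the first and on the last two of three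
  tensor factors, and let \<open>f\<^sub>1\<^sub>2, f\<^sub>1\<^sub>3, f\<^sub>2\<^sub>3\<close> be the legs of \<open>f\<close>. The theorem holds because \<open>c\<close> can be
  moved past all legs: if
  \<open>f\<^sub>1\<^sub>2 c\<^sub>2 = c\<^sub>2 f\<^sub>1\<^sub>3\<close>, \<open>f\<^sub>2\<^sub>3 c\<^sub>1 = c\<^sub>1 f\<^sub>1\<^sub>3\<close>, \<open>f\<^sub>1\<^sub>3 c\<^sub>1 = c\<^sub>1 f\<^sub>2\<^sub>3\<close> and \<open>f\<^sub>1\<^sub>3 c\<^sub>2 = c\<^sub>2 f\<^sub>1\<^sub>2\<close>,
  then the two sides of the Yang-Baxter equation for \<open>c f\<close> become
  \<open>c\<^sub>1 c\<^sub>2 c\<^sub>1 f\<^sub>2\<^sub>3 f\<^sub>1\<^sub>3 f\<^sub>1\<^sub>2\<close> and \<open>c\<^sub>2 c\<^sub>1 c\<^sub>2 f\<^sub>1\<^sub>2 f\<^sub>1\<^sub>3 f\<^sub>2\<^sub>3\<close>. Since \<open>c\<close> is invertible and satisfies the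
  Yang-Baxter equation itself, the equation for \<open>c f\<close> says exactly that the legs of \<open>f\<close> satisfy
  \<open>f\<^sub>1\<^sub>2 f\<^sub>1\<^sub>3 f\<^sub>2\<^sub>3 = f\<^sub>2\<^sub>3 f\<^sub>1\<^sub>3 f\<^sub>1\<^sub>2\<close> (\<open>yang_baxter_iff_legs\<close>).

  The transposition is the operator \<open>c\<close> of the trivial rack, in which \<open>op x y = x\<close>, and for that
  rack the four relations hold for every map \<open>f\<close> of the tensor square. So the equation
  for \<open>\<tau> f\<close>, with \<open>\<tau>\<close> the transposition, is equivalent to the same condition on legs
  (\<open>yang_baxter_transposition_iff_legs\<close>).

  For the given rack the relations come from entropicity. Its case \<open>i = 1\<close> says that
  \<open>c\<^sub>2\<inverse> f\<^sub>1\<^sub>2 c\<^sub>2 = c\<^sub>1\<inverse> f\<^sub>2\<^sub>3 c\<^sub>1\<close>; call this map \<open>g\<close>. The first expression shows that \<open>g\<close> treats the outer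
  two letters of a word as \<open>f\<^sub>1\<^sub>3\<close> does, but might change the middle letter according to the output of
  \<open>f\<close>; the second shows that \<open>g\<close> keeps the middle letter. Hence \<open>g = f\<^sub>1\<^sub>3\<close> (\<open>middle_eq_f13\<close>), which is
  the first pair of relations. The cases \<open>i = 0\<close> and \<open>i = 2\<close>, that is
  \<open>f\<^sub>1\<^sub>2 c\<^sub>2 c\<^sub>1 = c\<^sub>2 c\<^sub>1 f\<^sub>2\<^sub>3\<close> and \<open>f\<^sub>2\<^sub>3 c\<^sub>1 c\<^sub>2 = c\<^sub>1 c\<^sub>2 f\<^sub>1\<^sub>2\<close>, then give the second pair by cancellation.
\<close>

section \<open>Linear extension from a basis\<close>

lemma lookup_smult: "Poly_Mapping.lookup (smult a v) w = a * Poly_Mapping.lookup v w"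
  unfolding smult_def by (simp add: Poly_Mapping.map.rep_eq when_def)

lemma smult_add: "smult a (u + v) = smult a u + smult a v"
  by (rule poly_mapping_eqI) (simp add: lookup_smult lookup_add algebra_simps)

lemma add_smult: "smult (a + b) v = smult a v + smult b v"
  by (rule poly_mapping_eqI) (simp add: lookup_smult lookup_add algebra_simps)

lemma smult_smult: "smult a (smult b v) = smult (a * b) v"
  by (rule poly_mapping_eqI) (simp add: lookup_smult algebra_simps)

lemma smult_0 [simp]: "smult 0 v = 0"
  by (rule poly_mapping_eqI) (simp add: lookup_smult)

lemma smult_1 [simp]: "smult 1 v = v"
  by (rule poly_mapping_eqI) (simp add: lookup_smult)

lemma smult_zero [simp]: "smult a 0 = 0"
  by (rule poly_mapping_eqI) (simp add: lookup_smult)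

lemma smult_sum: "smult a (sum g S) = (\<Sum>x\<in>S. smult a (g x))"
  by (induction S rule: infinite_finite_induct) (simp_all add: smult_add)

lemma lin_ext_superset:
  assumes "finite S" "Poly_Mapping.keys v \<subseteq> S"
  shows "lin_ext g v = (\<Sum>w\<in>S. smult (Poly_Mapping.lookup v w) (g w))"
  unfolding lin_ext_def using assms
  by (intro sum.mono_neutral_left) (auto simp: in_keys_iff)

lemma keys_smult: "Poly_Mapping.keys (smult a v) \<subseteq> Poly_Mapping.keys v"
  by (auto simp: in_keys_iff lookup_smult)

lemma linear_on_lin_ext: "linear_on UNIV (lin_ext g)"
proof -
  have "lin_ext g (u + v) = lin_ext g u + lin_ext g v" for u v
  proof -
    let ?S = "Poly_Mapping.keys u \<union> Poly_Mapping.keys v"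
    have "Poly_Mapping.keys (u + v) \<subseteq> ?S" by (rule Poly_Mapping.keys_add)
    then show ?thesis
      by (simp add: lin_ext_superset[of ?S] lookup_add add_smult sum.distrib)
  qed
  moreover have "lin_ext g (smult a v) = smult a (lin_ext g v)" for a v
    using keys_smult[of a v]
    by (simp add: lin_ext_superset[of "Poly_Mapping.keys v"] lookup_smult smult_sum smult_smult)
  ultimately show ?thesis by (simp add: linear_on_def)
qed

lemma linear_on_comp:
  "linear_on UNIV A \<Longrightarrow> linear_on UNIV B \<Longrightarrow> linear_on UNIV (\<lambda>v. A (B v))"
  by (simp add: linear_on_def)

lemma lin_ext_basis [simp]: "lin_ext g (basis w) = g w"
  by (simp add: lin_ext_def basis_def)

lemma lin_ext_of_basis [simp]: "lin_ext basis v = v"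
proof (rule poly_mapping_eqI)
  fix k
  have "Poly_Mapping.lookup (lin_ext basis v) k
      = (\<Sum>w\<in>Poly_Mapping.keys v. if w = k then Poly_Mapping.lookup v w else 0)"
    unfolding lin_ext_def lookup_sum
    by (intro sum.cong) (auto simp: lookup_smult basis_def lookup_single when_def)
  then show "Poly_Mapping.lookup (lin_ext basis v) k = Poly_Mapping.lookup v k"
    by (simp add: in_keys_iff)
qed

lemma lin_ext_cong:
  "(\<And>w. w \<in> Poly_Mapping.keys v \<Longrightarrow> g w = h w) \<Longrightarrow> lin_ext g v = lin_ext h v"
  unfolding lin_ext_def by (intro sum.cong) auto

text \<open>
  The maps of tensor powers below are composites of maps \<open>lin_ext g\<close>. Pushing a linear
  map inside \<open>lin_ext\<close> reduces an identity between such composites to a computation on single words.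
\<close>

lemma linear_lin_ext:
  fixes h :: "'b \<Rightarrow> ('c \<Rightarrow>\<^sub>0 'a::comm_ring_1)"
  assumes "linear_on UNIV A"
  shows "A (lin_ext h v) = lin_ext (\<lambda>w. A (h w)) v"
proof -
  have A: "A (x + y) = A x + A y" "A (smult a x) = smult a (A x)" for x y a
    using assms by (auto simp: linear_on_def)
  have A0: "A 0 = 0" using A(2)[of 0 0] by simp
  have "A (sum k S) = (\<Sum>x\<in>S. A (k x))" for k :: "'b \<Rightarrow> _" and S
    by (induction S rule: infinite_finite_induct) (simp_all add: A A0)
  then show ?thesis by (simp add: lin_ext_def A)
qed

lemmas lin_ext_lin_ext = linear_lin_ext[OF linear_on_lin_ext]

lemma linear_eq_on_basis:
  assumes "linear_on UNIV A" "linear_on UNIV B"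
    and "\<And>w. w \<in> Poly_Mapping.keys v \<Longrightarrow> A (basis w) = B (basis w)"
  shows "A v = B v"
proof -
  have "A v = lin_ext (\<lambda>w. A (basis w)) v"
    using linear_lin_ext[OF assms(1), of basis v] by simp
  also have "\<dots> = lin_ext (\<lambda>w. B (basis w)) v" by (rule lin_ext_cong) (rule assms(3))
  also have "\<dots> = B v" using linear_lin_ext[OF assms(2), of basis v] by simp
  finally show ?thesis .
qed

lemma keys_lin_ext:
  "Poly_Mapping.keys (lin_ext g v) \<subseteq> (\<Union>w\<in>Poly_Mapping.keys v. Poly_Mapping.keys (g w))"
  unfolding lin_ext_def by (rule order_trans[OF keys_sum UN_mono[OF order_refl keys_smult]])

lemma keys_basis [simp]: "Poly_Mapping.keys (basis w) = {w}"
  by (simp add: basis_def)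

lemma tens_basis_right: "tens u (basis y) = lin_ext (\<lambda>x. basis (x @ y)) u"
  by (simp add: tens_def)

lemma tens_basis_left: "tens (basis x) v = lin_ext (\<lambda>y. basis (x @ y)) v"
  by (simp add: tens_def)

section \<open>Permutations of a basis\<close>

lemma permuted_basis_inverse:
  assumes "inj_on \<sigma> W" "Poly_Mapping.keys v \<subseteq> W"
  shows "lin_ext (\<lambda>w. basis (inv_into W \<sigma> w)) (lin_ext (\<lambda>w. basis (\<sigma> w)) v) = v"
proof -
  have "lin_ext (\<lambda>w. basis (inv_into W \<sigma> (\<sigma> w))) v = lin_ext basis v"
    by (rule lin_ext_cong) (simp only: inv_into_f_f[OF assms(1) subsetD[OF assms(2)]])
  then show ?thesis by (simp only: lin_ext_lin_ext lin_ext_basis lin_ext_of_basis)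
qed

lemma keys_relabelled: "Poly_Mapping.keys (lin_ext (\<lambda>w. basis (\<sigma> w)) v) \<subseteq> \<sigma> ` Poly_Mapping.keys v"
  using keys_lin_ext[of "\<lambda>w. basis (\<sigma> w)" v] by (simp add: UNION_singleton_eq_range)

text \<open>
  Injectivity rules out cancellation: no word of the support is lost when words are relabelled.
\<close>

lemma keys_permuted_basis:
  assumes "inj_on \<sigma> W" "Poly_Mapping.keys v \<subseteq> W" "w \<in> Poly_Mapping.keys v"
  shows "\<sigma> w \<in> Poly_Mapping.keys (lin_ext (\<lambda>w. basis (\<sigma> w)) v)"
proof -
  let ?u = "lin_ext (\<lambda>w. basis (\<sigma> w)) v"
  have sub: "Poly_Mapping.keys ?u \<subseteq> \<sigma> ` W"
    by (rule order_trans[OF keys_relabelled]) (use assms(2) in auto)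
  have "w \<in> Poly_Mapping.keys (lin_ext (\<lambda>w. basis (inv_into W \<sigma> w)) ?u)"
    by (simp only: permuted_basis_inverse[OF assms(1,2)] assms(3))
  then obtain k where k: "k \<in> Poly_Mapping.keys ?u" "w = inv_into W \<sigma> k"
    using keys_relabelled[of "inv_into W \<sigma>" ?u] by blast
  then have "\<sigma> w = k" using f_inv_into_f[OF subsetD[OF sub]] by blast
  with k(1) show ?thesis by blast
qed

lemma bij_betw_permuted_basis:
  assumes "bij_betw \<sigma> W W"
  shows "bij_betw (lin_ext (\<lambda>w. basis (\<sigma> w)) :: ('b \<Rightarrow>\<^sub>0 'a::comm_ring_1) \<Rightarrow> _)
           {v. Poly_Mapping.keys v \<subseteq> W} {v. Poly_Mapping.keys v \<subseteq> W}"
proof -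
  let ?\<tau> = "inv_into W \<sigma>"
  have \<tau>: "bij_betw ?\<tau> W W" using assms by (rule bij_betw_inv_into)
  have stable: "Poly_Mapping.keys (lin_ext (\<lambda>w. basis (\<pi> w)) v) \<subseteq> W"
    if "bij_betw \<pi> W W" "Poly_Mapping.keys v \<subseteq> W" for \<pi> and v :: "'b \<Rightarrow>\<^sub>0 'a"
    by (rule order_trans[OF keys_relabelled]) (use that bij_betwE[OF that(1)] in auto)
  show ?thesis
  proof (rule bij_betw_byWitness[where f' = "lin_ext (\<lambda>w. basis (?\<tau> w))"])
    show "\<forall>v\<in>{v :: 'b \<Rightarrow>\<^sub>0 'a. Poly_Mapping.keys v \<subseteq> W}.
        lin_ext (\<lambda>w. basis (?\<tau> w)) (lin_ext (\<lambda>w. basis (\<sigma> w)) v) = v"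
      by (simp add: permuted_basis_inverse[OF bij_betw_imp_inj_on[OF assms]])
    show "\<forall>v\<in>{v :: 'b \<Rightarrow>\<^sub>0 'a. Poly_Mapping.keys v \<subseteq> W}.
        lin_ext (\<lambda>w. basis (\<sigma> w)) (lin_ext (\<lambda>w. basis (?\<tau> w)) v) = v"
    proof
      fix v :: "'b \<Rightarrow>\<^sub>0 'a" assume "v \<in> {v. Poly_Mapping.keys v \<subseteq> W}"
      then have "lin_ext (\<lambda>w. basis (\<sigma> (?\<tau> w))) v = lin_ext basis v"
        using bij_betw_inv_into_right[OF assms] by (intro lin_ext_cong) (auto simp: subset_iff)
      then show "lin_ext (\<lambda>w. basis (\<sigma> w)) (lin_ext (\<lambda>w. basis (?\<tau> w)) v) = v"
        by (simp only: lin_ext_lin_ext lin_ext_basis lin_ext_of_basis)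
    qed
  qed (simp_all add: image_subset_iff stable[OF assms] stable[OF \<tau>])
qed

section \<open>Maps on three tensor factors\<close>

lemma words2D:
  assumes "w \<in> Poly_Mapping.keys v" "v \<in> tpow Q 2"
  obtains x y where "w = [x, y]" "x \<in> Q" "y \<in> Q"
  using assms by (fastforce simp: tpow_def numeral_2_eq_2 length_Suc_conv)

lemma words3D:
  assumes "w \<in> Poly_Mapping.keys v" "v \<in> tpow Q 3"
  obtains x y z where "w = [x, y, z]" "x \<in> Q" "y \<in> Q" "z \<in> Q"
  using assms by (fastforce simp: tpow_def numeral_3_eq_3 length_Suc_conv)

lemma basis_in_tpow: "length w = n \<Longrightarrow> set w \<subseteq> Q \<Longrightarrow> basis w \<in> tpow Q n"
  by (simp add: tpow_def)

lemma lin_ext_in_tpow: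
  assumes "\<And>w. w \<in> Poly_Mapping.keys v \<Longrightarrow> g w \<in> tpow Q n"
  shows "lin_ext g v \<in> tpow Q n"
  using keys_lin_ext[of g v] assms unfolding tpow_def by blast

text \<open>
  It suffices to compare linear maps on the words over \<open>Q\<close>: the words with letters outside \<open>Q\<close>, on
  which the maps may differ, do not occur in elements of \<open>tpow Q 3\<close>.
\<close>

lemma tpow3_eqI:
  assumes "v \<in> tpow Q 3" "linear_on UNIV A" "linear_on UNIV B"
    and "\<And>x y z. x \<in> Q \<Longrightarrow> y \<in> Q \<Longrightarrow> z \<in> Q \<Longrightarrow> A (basis [x, y, z]) = B (basis [x, y, z])"
  shows "A v = B v"
proof (rule linear_eq_on_basis[OF assms(2,3)])
  fix w assume "w \<in> Poly_Mapping.keys v"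
  then obtain x y z where "w = [x, y, z]" "x \<in> Q" "y \<in> Q" "z \<in> Q" using assms(1) by (rule words3D)
  then show "A (basis w) = B (basis w)" by (simp add: assms(4))
qed

lemma tpow3_stable:
  assumes "v \<in> tpow Q 3" "linear_on UNIV A"
    and "\<And>x y z. x \<in> Q \<Longrightarrow> y \<in> Q \<Longrightarrow> z \<in> Q \<Longrightarrow> A (basis [x, y, z]) \<in> tpow Q 3"
  shows "A v \<in> tpow Q 3"
proof -
  have "A v = lin_ext (\<lambda>w. A (basis w)) v" using linear_lin_ext[OF assms(2), of basis v] by simp
  also have "\<dots> \<in> tpow Q 3"
  proof (rule lin_ext_in_tpow)
    fix w assume "w \<in> Poly_Mapping.keys v"
    then obtain x y z where "w = [x, y, z]" "x \<in> Q" "y \<in> Q" "z \<in> Q" using assms(1) by (rule words3D)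
    then show "A (basis w) \<in> tpow Q 3" by (simp add: assms(3))
  qed
  finally show ?thesis .
qed

lemma linear_on_tmap: "linear_on UNIV (tmap m f g)"
  unfolding tmap_def by (rule linear_on_lin_ext)

lemma linear_on_leg: "linear_on UNIV (leg f i j)"
  unfolding leg_def by (rule linear_on_lin_ext)

lemma tmap_left_basis:
  "tmap 2 f id (basis [x, y, z]) = lin_ext (\<lambda>p. basis (p @ [z])) (f (basis [x, y]))"
  by (simp add: tmap_def tens_basis_right)

lemma tmap_right_basis:
  "tmap 1 id f (basis [x, y, z]) = lin_ext (\<lambda>p. basis (x # p)) (f (basis [y, z]))"
  by (simp add: tmap_def tens_basis_left)

lemma leg13_basis:
  "leg f 1 3 (basis [x, y, z]) = lin_ext (\<lambda>p. basis [p ! 0, y, p ! 1]) (f (basis [x, z]))"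
  by (simp add: leg_def numeral_2_eq_2)

lemma tmap_left_cQ_basis:
  "tmap 2 (cQ op) id (basis [x, y, z]) = basis [y, op x y, z]"
  unfolding tmap_left_basis by (simp add: cQ_def)

lemma tmap_right_cQ_basis:
  "tmap 1 id (cQ op) (basis [x, y, z]) = basis [x, z, op y z]"
  unfolding tmap_right_basis by (simp add: cQ_def)

text \<open>
  The value of \<open>f\<close> on a two-letter word is a combination of two-letter words over \<open>Q\<close>, so
  identities between maps built from \<open>f\<close> can be checked letter by letter on its output
  (\<open>lin_ext_pair_cong\<close>).
\<close>

locale pair_map =
  fixes Q :: "'q set" and f :: "('q list \<Rightarrow>\<^sub>0 'a::comm_ring_1) \<Rightarrow> ('q list \<Rightarrow>\<^sub>0 'a)"
  assumes pair_stable: "v \<in> tpow Q 2 \<Longrightarrow> f v \<in> tpow Q 2"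
begin

lemma pair_word:
  assumes "w \<in> Poly_Mapping.keys (f (basis [x, y]))" "x \<in> Q" "y \<in> Q"
  obtains u v where "w = [u, v]" "u \<in> Q" "v \<in> Q"
proof -
  have "f (basis [x, y]) \<in> tpow Q 2" using assms by (intro pair_stable basis_in_tpow) auto
  with assms(1) show thesis by (rule words2D) (rule that)
qed

lemma lin_ext_pair_in_tpow:
  assumes "x \<in> Q" "y \<in> Q" "\<And>u v. u \<in> Q \<Longrightarrow> v \<in> Q \<Longrightarrow> g [u, v] \<in> tpow Q n"
  shows "lin_ext g (f (basis [x, y])) \<in> tpow Q n"
proof (rule lin_ext_in_tpow)
  fix w assume "w \<in> Poly_Mapping.keys (f (basis [x, y]))"
  then obtain u v where "w = [u, v]" "u \<in> Q" "v \<in> Q" using assms(1,2) by (rule pair_word)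
  then show "g w \<in> tpow Q n" by (simp add: assms(3))
qed

lemma lin_ext_pair_cong:
  assumes "x \<in> Q" "y \<in> Q" "\<And>u v. u \<in> Q \<Longrightarrow> v \<in> Q \<Longrightarrow> g [u, v] = h [u, v]"
  shows "lin_ext g (f (basis [x, y])) = lin_ext h (f (basis [x, y]))"
proof (rule lin_ext_cong)
  fix w assume "w \<in> Poly_Mapping.keys (f (basis [x, y]))"
  then obtain u v where "w = [u, v]" "u \<in> Q" "v \<in> Q" using assms(1,2) by (rule pair_word)
  then show "g w = h w" by (simp add: assms(3))
qed

lemma left_stable: "v \<in> tpow Q 3 \<Longrightarrow> tmap 2 f id v \<in> tpow Q 3"
  by (erule tpow3_stable[OF _ linear_on_tmap], unfold tmap_left_basis, rule lin_ext_pair_in_tpow)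
    (simp_all add: basis_in_tpow)

lemma right_stable: "v \<in> tpow Q 3 \<Longrightarrow> tmap 1 id f v \<in> tpow Q 3"
  by (erule tpow3_stable[OF _ linear_on_tmap], unfold tmap_right_basis, rule lin_ext_pair_in_tpow)
    (simp_all add: basis_in_tpow)

lemma outer_stable: "v \<in> tpow Q 3 \<Longrightarrow> leg f 1 3 v \<in> tpow Q 3"
  by (erule tpow3_stable[OF _ linear_on_leg], unfold leg13_basis, rule lin_ext_pair_in_tpow)
    (simp_all add: basis_in_tpow)

lemma leg12_eq: "v \<in> tpow Q 3 \<Longrightarrow> leg f 1 2 v = tmap 2 f id v"
  by (erule tpow3_eqI[OF _ linear_on_leg linear_on_tmap], unfold tmap_left_basis)
    (simp add: leg_def, rule lin_ext_pair_cong, simp_all)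

lemma leg23_eq: "v \<in> tpow Q 3 \<Longrightarrow> leg f 2 3 v = tmap 1 id f v"
  by (erule tpow3_eqI[OF _ linear_on_leg linear_on_tmap], unfold tmap_right_basis)
    (simp add: leg_def numeral_2_eq_2, rule lin_ext_pair_cong, simp_all)

lemma tmap_left_comp:
  assumes "v \<in> tpow Q 3"
  shows "tmap 2 (cQ op \<circ> f) id v = tmap 2 (cQ op) id (tmap 2 f id v)"
proof (rule tpow3_eqI[OF assms linear_on_tmap linear_on_comp[OF linear_on_tmap linear_on_tmap]])
  fix x y z assume "x \<in> Q" "y \<in> Q" "z \<in> Q"
  then show "tmap 2 (cQ op \<circ> f) id (basis [x, y, z]) = tmap 2 (cQ op) id (tmap 2 f id (basis [x, y, z]))"
    unfolding tmap_left_basis linear_lin_ext[OF linear_on_tmap] comp_apply cQ_def lin_ext_lin_ext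
    unfolding lin_ext_basis
    by (intro lin_ext_pair_cong) (simp_all add: tmap_left_cQ_basis[unfolded cQ_def One_nat_def])
qed

lemma tmap_right_comp:
  assumes "v \<in> tpow Q 3"
  shows "tmap 1 id (cQ op \<circ> f) v = tmap 1 id (cQ op) (tmap 1 id f v)"
proof (rule tpow3_eqI[OF assms linear_on_tmap linear_on_comp[OF linear_on_tmap linear_on_tmap]])
  fix x y z assume "x \<in> Q" "y \<in> Q" "z \<in> Q"
  then show "tmap 1 id (cQ op \<circ> f) (basis [x, y, z]) = tmap 1 id (cQ op) (tmap 1 id f (basis [x, y, z]))"
    unfolding tmap_right_basis linear_lin_ext[OF linear_on_tmap] comp_apply cQ_def lin_ext_lin_ext
    unfolding lin_ext_basis
    by (intro lin_ext_pair_cong) (simp_all add: tmap_right_cQ_basis[unfolded cQ_def One_nat_def])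
qed

end


section \<open>The braiding of a rack\<close>

lemma tmap_left_cQ_permutes:
  "v \<in> tpow Q 3 \<Longrightarrow> tmap 2 (cQ op) id v = lin_ext (\<lambda>w. basis [w ! 1, op (w ! 0) (w ! 1), w ! 2]) v"
  by (erule tpow3_eqI[OF _ linear_on_tmap linear_on_lin_ext], unfold tmap_left_cQ_basis) simp

lemma tmap_right_cQ_permutes:
  "v \<in> tpow Q 3 \<Longrightarrow> tmap 1 id (cQ op) v = lin_ext (\<lambda>w. basis [w ! 0, w ! 2, op (w ! 1) (w ! 2)]) v"
  by (erule tpow3_eqI[OF _ linear_on_tmap linear_on_lin_ext], unfold tmap_right_cQ_basis) simp

context rack
begin

lemma op_closed: "x \<in> Q \<Longrightarrow> y \<in> Q \<Longrightarrow> op x y \<in> Q"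
  using bij_betwE[OF translation_bij[of y]] by blast

lemma op_cancel: "op x y = op x' y \<longleftrightarrow> x = x'" if "x \<in> Q" "x' \<in> Q" "y \<in> Q"
  by (rule inj_on_eq_iff[OF bij_betw_imp_inj_on[OF translation_bij[OF that(3)]] that(1,2)])

lemma op_surj:
  assumes "y \<in> Q" "z \<in> Q"
  obtains x where "x \<in> Q" "op x y = z"
proof -
  have "z \<in> (\<lambda>x. op x y) ` Q"
    using bij_betw_imp_surj_on[OF translation_bij[OF assms(1)]] assms(2) by simp
  then show thesis using that by blast
qed

lemma word3E:
  assumes "w \<in> {w. length w = 3 \<and> set w \<subseteq> Q}"
  obtains x y z where "w = [x, y, z]" "x \<in> Q" "y \<in> Q" "z \<in> Q"
  using assms by (auto simp: numeral_3_eq_3 length_Suc_conv)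

text \<open>
  On three-letter words, \<open>c\<^sub>1\<close> and \<open>c\<^sub>2\<close> are permutations, because right translations are.
\<close>

lemma bij_betw_words_left:
  "bij_betw (\<lambda>w. [w ! 1, op (w ! 0) (w ! 1), w ! 2])
     {w. length w = 3 \<and> set w \<subseteq> Q} {w. length w = 3 \<and> set w \<subseteq> Q}" (is "bij_betw ?s ?W ?W")
proof (rule bij_betw_imageI)
  show "inj_on ?s ?W"
  proof (rule inj_onI)
    fix w w' assume "w \<in> ?W" "w' \<in> ?W" and eq: "?s w = ?s w'"
    obtain x y z where w: "w = [x, y, z]" "x \<in> Q" "y \<in> Q" "z \<in> Q"
      using \<open>w \<in> ?W\<close> by (rule word3E)
    obtain x' y' z' where w': "w' = [x', y', z']" "x' \<in> Q" "y' \<in> Q" "z' \<in> Q"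
      using \<open>w' \<in> ?W\<close> by (rule word3E)
    have "y = y'" "z = z'" "op x y = op x' y" using eq w w' by auto
    moreover from this have "x = x'" using op_cancel w w' by blast
    ultimately show "w = w'" using w w' by simp
  qed
  show "?s ` ?W = ?W"
  proof (rule equalityI; rule subsetI)
    fix u assume "u \<in> ?s ` ?W"
    then obtain w where "w \<in> ?W" "u = ?s w" by blast
    moreover from \<open>w \<in> ?W\<close> obtain x y z where "w = [x, y, z]" "x \<in> Q" "y \<in> Q" "z \<in> Q"
      by (rule word3E)
    ultimately show "u \<in> ?W" by (simp add: op_closed)
  next
    fix w assume "w \<in> ?W"
    then obtain a b c where w: "w = [a, b, c]" "a \<in> Q" "b \<in> Q" "c \<in> Q" by (rule word3E)
    obtain x where "x \<in> Q" "op x a = b" using w(2,3) by (rule op_surj)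
    with w show "w \<in> ?s ` ?W" by (intro image_eqI[of _ _ "[x, a, c]"]) simp_all
  qed
qed

lemma bij_betw_words_right:
  "bij_betw (\<lambda>w. [w ! 0, w ! 2, op (w ! 1) (w ! 2)])
     {w. length w = 3 \<and> set w \<subseteq> Q} {w. length w = 3 \<and> set w \<subseteq> Q}" (is "bij_betw ?s ?W ?W")
proof (rule bij_betw_imageI)
  show "inj_on ?s ?W"
  proof (rule inj_onI)
    fix w w' assume "w \<in> ?W" "w' \<in> ?W" and eq: "?s w = ?s w'"
    obtain x y z where w: "w = [x, y, z]" "x \<in> Q" "y \<in> Q" "z \<in> Q"
      using \<open>w \<in> ?W\<close> by (rule word3E)
    obtain x' y' z' where w': "w' = [x', y', z']" "x' \<in> Q" "y' \<in> Q" "z' \<in> Q"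
      using \<open>w' \<in> ?W\<close> by (rule word3E)
    have "x = x'" "z = z'" "op y z = op y' z" using eq w w' by auto
    moreover from this have "y = y'" using op_cancel w w' by blast
    ultimately show "w = w'" using w w' by simp
  qed
  show "?s ` ?W = ?W"
  proof (rule equalityI; rule subsetI)
    fix u assume "u \<in> ?s ` ?W"
    then obtain w where "w \<in> ?W" "u = ?s w" by blast
    moreover from \<open>w \<in> ?W\<close> obtain x y z where "w = [x, y, z]" "x \<in> Q" "y \<in> Q" "z \<in> Q"
      by (rule word3E)
    ultimately show "u \<in> ?W" by (simp add: op_closed)
  next
    fix w assume "w \<in> ?W"
    then obtain a b c where w: "w = [a, b, c]" "a \<in> Q" "b \<in> Q" "c \<in> Q" by (rule word3E)
    obtain x where "x \<in> Q" "op x b = c" using w(3,4) by (rule op_surj)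
    with w show "w \<in> ?s ` ?W" by (intro image_eqI[of _ _ "[a, x, b]"]) simp_all
  qed
qed

lemma bij_left: "bij_betw (tmap 2 (cQ op) id) (tpow Q 3) (tpow Q 3)"
  by (rule iffD2[OF bij_betw_cong[OF tmap_left_cQ_permutes]], assumption, unfold tpow_def)
    (rule bij_betw_permuted_basis[OF bij_betw_words_left])

lemma bij_right: "bij_betw (tmap 1 id (cQ op)) (tpow Q 3) (tpow Q 3)"
  by (rule iffD2[OF bij_betw_cong[OF tmap_right_cQ_permutes]], assumption, unfold tpow_def)
    (rule bij_betw_permuted_basis[OF bij_betw_words_right])

lemma braid_relation:
  assumes "v \<in> tpow Q 3"
  shows "tmap 2 (cQ op) id (tmap 1 id (cQ op) (tmap 2 (cQ op) id v)) =
         tmap 1 id (cQ op) (tmap 2 (cQ op) id (tmap 1 id (cQ op) v))"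
proof (rule tpow3_eqI[OF assms])
  fix x y z assume "x \<in> Q" "y \<in> Q" "z \<in> Q"
  then show "tmap 2 (cQ op) id (tmap 1 id (cQ op) (tmap 2 (cQ op) id (basis [x, y, z]))) =
      tmap 1 id (cQ op) (tmap 2 (cQ op) id (tmap 1 id (cQ op) (basis [x, y, z])))"
    unfolding tmap_left_cQ_basis tmap_right_cQ_basis by (simp add: self_distrib)
qed (rule linear_on_comp[OF linear_on_tmap linear_on_comp[OF linear_on_tmap linear_on_tmap]])+

end

locale rack_pair_map = rack Q op + pair_map Q f
  for Q :: "'q set" and op :: "'q \<Rightarrow> 'q \<Rightarrow> 'q"
    and f :: "('q list \<Rightarrow>\<^sub>0 'a::comm_ring_1) \<Rightarrow> ('q list \<Rightarrow>\<^sub>0 'a)"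
begin

abbreviation "M \<equiv> tpow Q 3 :: ('q list \<Rightarrow>\<^sub>0 'a) set"
abbreviation "c1 \<equiv> tmap 2 (cQ op) id :: ('q list \<Rightarrow>\<^sub>0 'a) \<Rightarrow> _"
abbreviation "c2 \<equiv> tmap 1 id (cQ op) :: ('q list \<Rightarrow>\<^sub>0 'a) \<Rightarrow> _"
abbreviation "f12 \<equiv> tmap 2 f id"
abbreviation "f23 \<equiv> tmap 1 id f"
abbreviation "f13 \<equiv> leg f 1 3"

lemma c1_stable: "v \<in> M \<Longrightarrow> c1 v \<in> M" and c2_stable: "v \<in> M \<Longrightarrow> c2 v \<in> M"
  using bij_betwE[OF bij_left] bij_betwE[OF bij_right] by blast+

lemma c1_cancel: "u \<in> M \<Longrightarrow> v \<in> M \<Longrightarrow> c1 u = c1 v \<longleftrightarrow> u = v"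
  by (rule inj_on_eq_iff[OF bij_betw_imp_inj_on[OF bij_left]])

lemma c2_cancel: "u \<in> M \<Longrightarrow> v \<in> M \<Longrightarrow> c2 u = c2 v \<longleftrightarrow> u = v"
  by (rule inj_on_eq_iff[OF bij_betw_imp_inj_on[OF bij_right]])

lemmas stable = c1_stable c2_stable left_stable right_stable outer_stable

text \<open>
  The four relations allow every occurrence of the braiding to be collected on the left of all legs of
  \<open>f\<close>; what remains on the left is the same invertible map \<open>c\<^sub>1 c\<^sub>2 c\<^sub>1 = c\<^sub>2 c\<^sub>1 c\<^sub>2\<close> on both sides.
\<close>

lemma yang_baxter_iff_legs:
  assumes f12_c2: "\<And>v. v \<in> M \<Longrightarrow> f12 (c2 v) = c2 (f13 v)"
    and f23_c1: "\<And>v. v \<in> M \<Longrightarrow> f23 (c1 v) = c1 (f13 v)"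
    and f13_c1: "\<And>v. v \<in> M \<Longrightarrow> f13 (c1 v) = c1 (f23 v)"
    and f13_c2: "\<And>v. v \<in> M \<Longrightarrow> f13 (c2 v) = c2 (f12 v)"
  shows "yang_baxter Q (cQ op \<circ> f) \<longleftrightarrow>
    (\<forall>v\<in>M. (leg f 1 2 \<circ> leg f 1 3 \<circ> leg f 2 3) v = (leg f 2 3 \<circ> leg f 1 3 \<circ> leg f 1 2) v)"
proof -
  have "(tmap 2 (cQ op \<circ> f) id \<circ> tmap 1 id (cQ op \<circ> f) \<circ> tmap 2 (cQ op \<circ> f) id) v =
        (tmap 1 id (cQ op \<circ> f) \<circ> tmap 2 (cQ op \<circ> f) id \<circ> tmap 1 id (cQ op \<circ> f)) v \<longleftrightarrow>
        (leg f 1 2 \<circ> leg f 1 3 \<circ> leg f 2 3) v = (leg f 2 3 \<circ> leg f 1 3 \<circ> leg f 1 2) v"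
    (is "?l = ?r \<longleftrightarrow> ?l' = ?r'") if v: "v \<in> M" for v
  proof -
    note [simp del] = One_nat_def
    have "?l = c1 (f12 (c2 (f23 (c1 (f12 v)))))"
      by (simp add: tmap_left_comp tmap_right_comp stable v)
    also have "\<dots> = c1 (c2 (c1 (f23 (f13 (f12 v)))))"
      by (simp add: f12_c2 f23_c1 f13_c1 stable v)
    also have "\<dots> = c1 (c2 (c1 ?r'))"
      by (simp add: leg12_eq leg23_eq stable v)
    finally have l: "?l = c1 (c2 (c1 ?r'))" .
    have "?r = c2 (f23 (c1 (f12 (c2 (f23 v)))))"
      by (simp add: tmap_left_comp tmap_right_comp stable v)
    also have "\<dots> = c2 (c1 (c2 (f12 (f13 (f23 v)))))"
      by (simp add: f12_c2 f23_c1 f13_c2 stable v)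
    also have "\<dots> = c2 (c1 (c2 ?l'))"
      by (simp add: leg12_eq leg23_eq stable v)
    also have "\<dots> = c1 (c2 (c1 ?l'))"
      by (simp add: braid_relation leg12_eq leg23_eq stable v)
    finally have r: "?r = c1 (c2 (c1 ?l'))" .
    have "?l' \<in> M" "?r' \<in> M" by (simp_all add: leg12_eq leg23_eq stable v)
    then show ?thesis unfolding l r by (auto simp: c1_cancel c2_cancel stable)
  qed
  then show ?thesis by (simp add: yang_baxter_def)
qed

end

section \<open>Entropic maps slide through the braiding\<close>

lemma braid_gen_1: "v \<in> tpow Q 3 \<Longrightarrow> braid_gen c 1 v = tmap 2 c id v"
  unfolding braid_gen_def
  by (erule tpow3_eqI[OF _ linear_on_tmap linear_on_tmap])
    (simp add: tmap_def[of 0] tens_basis_left)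

lemma braid_gen_2: "v \<in> tpow Q 3 \<Longrightarrow> braid_gen c 2 v = tmap 1 id c v"
  unfolding braid_gen_def
  by (erule tpow3_eqI[OF _ linear_on_tmap linear_on_tmap])
    (simp add: tmap_def[of "Suc 0"] tmap_def[of 2] tens_basis_left tens_basis_right)

lemma inv_into_eq_inv_intoD:
  assumes "inv_into A L a = inv_into A R b" "bij_betw L A A" "bij_betw R A A" "a \<in> A" "b \<in> A"
  obtains u where "u \<in> A" "a = L u" "b = R u"
proof
  show "inv_into A L a \<in> A"
    using assms(2,4) by (simp add: bij_betw_def inv_into_into)
  show "a = L (inv_into A L a)"
    by (rule bij_betw_inv_into_right[OF assms(2,4), symmetric])
  show "b = R (inv_into A L a)"
    unfolding assms(1) by (rule bij_betw_inv_into_right[OF assms(3,5), symmetric])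
qed

context rack_pair_map
begin

text \<open>
  Entropicity is an equation between inverse images. Naming the common value \<open>u\<close> of both sides
  turns it into equations between the maps themselves, with \<open>L\<close> and \<open>R\<close> the two products of braidings.
\<close>

lemma entropic_factor:
  assumes "entropic Q (cQ op) 2 f" "i \<le> 2" "v \<in> M"
    and L: "\<And>w. w \<in> M \<Longrightarrow> comp_list (map (braid_gen (cQ op)) (rev [i + 1..<3])) w = L w"
    and R: "\<And>w. w \<in> M \<Longrightarrow> comp_list (map (braid_gen (cQ op)) [1..<i + 1]) w = R w"
    and bij: "bij_betw L M M" "bij_betw R M M"
  obtains u where "u \<in> M" "f12 (L v) = L u" "f23 (R v) = R u"
proof -
  let ?L = "comp_list (map (braid_gen (cQ op)) (rev [i + 1..<3])) :: ('q list \<Rightarrow>\<^sub>0 'a) \<Rightarrow> _"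
  let ?R = "comp_list (map (braid_gen (cQ op)) [1..<i + 1]) :: ('q list \<Rightarrow>\<^sub>0 'a) \<Rightarrow> _"
  have "i \<in> {0..2}" using assms(2) by simp
  then have eq: "inv_into M ?L (f12 (?L v)) = inv_into M ?R (f23 (?R v))"
    using assms(1,3) unfolding entropic_def Let_def by (simp del: upt_Suc One_nat_def add: numeral_3_eq_3)
  have bij': "bij_betw ?L M M" "bij_betw ?R M M"
    by (rule iffD2[OF bij_betw_cong[OF L] bij(1)], assumption)
      (rule iffD2[OF bij_betw_cong[OF R] bij(2)])
  have "?L v \<in> M" "?R v \<in> M" using bij_betwE[OF bij'(1)] bij_betwE[OF bij'(2)] assms(3) by simp_all
  then obtain u where "u \<in> M" "f12 (?L v) = ?L u" "f23 (?R v) = ?R u"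
    using inv_into_eq_inv_intoD[OF eq bij' left_stable right_stable] by blast
  then show thesis using that by (simp only: L R assms(3))
qed

lemma braid_words:
  "rev [0 + 1..<3::nat] = [2, 1]" "rev [1 + 1..<3::nat] = [2]" "rev [2 + 1..<3::nat] = []"
  "[1..<0 + 1::nat] = []" "[1..<1 + 1::nat] = [1]" "[1..<2 + 1::nat] = [1, 2]"
  by (simp_all add: upt_rec)

lemma f12_slide_c2_c1:
  assumes "entropic Q (cQ op) 2 f" "v \<in> M"
  shows "f12 (c2 (c1 v)) = c2 (c1 (f23 v))"
proof -
  obtain u where "u \<in> M" "f12 ((c2 \<circ> c1) v) = (c2 \<circ> c1) u" "f23 (id v) = id u"
    by (rule entropic_factor[OF assms(1) _ assms(2), of 0 "c2 \<circ> c1" id])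
      (simp_all only: braid_words comp_list_def list.map foldr.simps comp_apply id_apply
        braid_gen_1[of _ Q] braid_gen_2[of _ Q] stable bij_betw_id bij_betw_trans[OF bij_left bij_right] le0)
  then show ?thesis by simp
qed

lemma f23_slide_c1_c2:
  assumes "entropic Q (cQ op) 2 f" "v \<in> M"
  shows "f23 (c1 (c2 v)) = c1 (c2 (f12 v))"
proof -
  obtain u where "u \<in> M" "f12 (id v) = id u" "f23 ((c1 \<circ> c2) v) = (c1 \<circ> c2) u"
    by (rule entropic_factor[OF assms(1) _ assms(2), of 2 id "c1 \<circ> c2"])
      (simp_all only: braid_words comp_list_def list.map foldr.simps comp_apply id_apply
        braid_gen_1[of _ Q] braid_gen_2[of _ Q] stable bij_betw_id bij_betw_trans[OF bij_right bij_left] order_refl)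
  then show ?thesis by simp
qed

lemma entropic_middle:
  assumes "entropic Q (cQ op) 2 f" "v \<in> M"
  obtains u where "u \<in> M" "f12 (c2 v) = c2 u" "f23 (c1 v) = c1 u"
  by (rule entropic_factor[OF assms(1) _ assms(2), of 1 c2 c1])
    (simp_all only: braid_words comp_list_def list.map foldr.simps comp_apply id_apply
        braid_gen_1[of _ Q] braid_gen_2[of _ Q] stable bij_left bij_right one_le_numeral)

text \<open>
  The vector \<open>u\<close> is the value at \<open>x \<otimes> y \<otimes> z\<close> of the conjugate \<open>c\<^sub>2\<inverse> f\<^sub>1\<^sub>2 c\<^sub>2 = c\<^sub>1\<inverse> f\<^sub>2\<^sub>3 c\<^sub>1\<close>. As \<open>c\<^sub>1\<close> moves
  the middle letter to the front, where \<open>f\<^sub>2\<^sub>3\<close> does not touch it, all words of \<open>u\<close> have middle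
  letter \<open>y\<close>. So \<open>u\<close> is determined by the outer letters of its words, and these are the first two
  letters of the words of \<open>c\<^sub>2 u = f\<^sub>1\<^sub>2 (c\<^sub>2 (x \<otimes> y \<otimes> z))\<close>, hence the output of \<open>f\<close> on \<open>x \<otimes> z\<close>.
\<close>

lemma middle_eq_f13:
  assumes x: "x \<in> Q" and y: "y \<in> Q" and z: "z \<in> Q" and u: "u \<in> M"
    and left: "f12 (c2 (basis [x, y, z])) = c2 u"
    and right: "f23 (c1 (basis [x, y, z])) = c1 u"
  shows "u = f13 (basis [x, y, z])"
proof -
  have c1_u: "c1 u = lin_ext (\<lambda>p. basis (y # p)) (f (basis [op x y, z]))"
    using right unfolding tmap_left_cQ_basis tmap_right_basis by simp
  have mid: "w ! 1 = y" if w: "w \<in> Poly_Mapping.keys u" for w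
  proof -
    have "Poly_Mapping.keys u \<subseteq> {w. length w = 3 \<and> set w \<subseteq> Q}"
      using u by (simp add: tpow_def)
    then have "[w ! 1, op (w ! 0) (w ! 1), w ! 2] \<in> Poly_Mapping.keys (c1 u)"
      unfolding tmap_left_cQ_permutes[OF u]
      using keys_permuted_basis[OF bij_betw_imp_inj_on[OF bij_betw_words_left]] w by blast
    also have "\<dots> \<subseteq> (\<lambda>p. y # p) ` Poly_Mapping.keys (f (basis [op x y, z]))"
      unfolding c1_u by (rule keys_relabelled)
    finally show ?thesis by auto
  qed
  \<comment> \<open>\<open>D\<close> drops the last letter and puts \<open>y\<close> in the middle. It undoes \<open>c\<^sub>2\<close> on words with middle
    letter \<open>y\<close>, since the dropped letter is the only one that \<open>c\<^sub>2\<close> computes with the rack operation.\<close>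
  define D :: "('q list \<Rightarrow>\<^sub>0 'a) \<Rightarrow> ('q list \<Rightarrow>\<^sub>0 'a)"
    where "D = lin_ext (\<lambda>w. basis [w ! 0, y, w ! 1])"
  have lin_D: "linear_on UNIV D" unfolding D_def by (rule linear_on_lin_ext)
  have "D (c2 u) = u"
  proof (rule linear_eq_on_basis[OF linear_on_comp[OF lin_D linear_on_tmap], of "\<lambda>v. v"])
    show "linear_on UNIV (\<lambda>v. v)" by (simp add: linear_on_def)
    fix w assume w: "w \<in> Poly_Mapping.keys u"
    then obtain a b c where abc: "w = [a, b, c]" using u by (rule words3D)
    with mid[OF w] have "b = y" by simp
    then show "D (c2 (basis w)) = basis w"
      unfolding abc tmap_right_cQ_basis by (simp add: D_def)
  qed
  moreover have "D (f12 (c2 (basis [x, y, z]))) = f13 (basis [x, y, z])"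
    unfolding tmap_right_cQ_basis tmap_left_basis leg13_basis linear_lin_ext[OF lin_D]
    by (rule lin_ext_pair_cong[OF x z]) (simp add: D_def)
  ultimately show ?thesis using left by simp
qed

lemma entropic_f12_c2:
  assumes "entropic Q (cQ op) 2 f" "v \<in> M"
  shows "f12 (c2 v) = c2 (f13 v)"
proof (rule tpow3_eqI[OF assms(2) linear_on_comp[OF linear_on_tmap linear_on_tmap]
      linear_on_comp[OF linear_on_tmap linear_on_leg]])
  fix x y z assume xyz: "x \<in> Q" "y \<in> Q" "z \<in> Q"
  then have "basis [x, y, z] \<in> M" by (simp add: basis_in_tpow)
  then obtain u where u: "u \<in> M" "f12 (c2 (basis [x, y, z])) = c2 u" "f23 (c1 (basis [x, y, z])) = c1 u"
    using entropic_middle[OF assms(1)] by blast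
  show "f12 (c2 (basis [x, y, z])) = c2 (f13 (basis [x, y, z]))"
    using middle_eq_f13[OF xyz u] u(2) by simp
qed

lemma entropic_f23_c1:
  assumes "entropic Q (cQ op) 2 f" "v \<in> M"
  shows "f23 (c1 v) = c1 (f13 v)"
proof -
  obtain u where u: "u \<in> M" "f12 (c2 v) = c2 u" "f23 (c1 v) = c1 u"
    using entropic_middle[OF assms] by blast
  then have "c2 u = c2 (f13 v)" using entropic_f12_c2[OF assms] by simp
  then have "u = f13 v" by (simp only: c2_cancel u(1) outer_stable assms(2))
  with u(3) show ?thesis by simp
qed

lemma entropic_f13_c1:
  assumes "entropic Q (cQ op) 2 f" "v \<in> M"
  shows "f13 (c1 v) = c1 (f23 v)"
proof -
  have "c2 (f13 (c1 v)) = c2 (c1 (f23 v))"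
    using entropic_f12_c2[OF assms(1) c1_stable[OF assms(2)]] f12_slide_c2_c1[OF assms] by simp
  then show ?thesis by (simp only: c2_cancel stable assms(2))
qed

lemma entropic_f13_c2:
  assumes "entropic Q (cQ op) 2 f" "v \<in> M"
  shows "f13 (c2 v) = c2 (f12 v)"
proof -
  have "c1 (f13 (c2 v)) = c1 (c2 (f12 v))"
    using entropic_f23_c1[OF assms(1) c2_stable[OF assms(2)]] f23_slide_c1_c2[OF assms] by simp
  then show ?thesis by (simp only: c1_cancel stable assms(2))
qed

end

section \<open>The trivial rack\<close>

lemma rack_trivial: "rack Q (\<lambda>x y. x)"
  by unfold_locales (simp_all add: bij_betw_def)

lemma transposition_eq_cQ: "transposition = cQ (\<lambda>x y. x)"
  by (simp add: transposition_def cQ_def)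

context pair_map
begin

text \<open>
  The braiding of the trivial rack permutes the tensor factors, and conjugating by a permutation of the
  factors permutes the legs of \<open>f\<close> accordingly: these are the four relations.
\<close>

lemma yang_baxter_transposition_iff_legs:
  "yang_baxter Q (transposition \<circ> f) \<longleftrightarrow>
    (\<forall>v\<in>tpow Q 3. (leg f 1 2 \<circ> leg f 1 3 \<circ> leg f 2 3) v = (leg f 2 3 \<circ> leg f 1 3 \<circ> leg f 1 2) v)"
proof -
  interpret rack Q "\<lambda>x y. x" by (rule rack_trivial)
  interpret rack_pair_map Q "\<lambda>x y. x" f ..
  show ?thesis
    unfolding transposition_eq_cQ
  proof (rule yang_baxter_iff_legs)
    fix v :: "'q list \<Rightarrow>\<^sub>0 'a" assume v: "v \<in> M"
    show "f12 (c2 v) = c2 (f13 v)"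
      by (rule tpow3_eqI[OF v linear_on_comp[OF linear_on_tmap linear_on_tmap]
            linear_on_comp[OF linear_on_tmap linear_on_leg]],
          unfold tmap_right_cQ_basis tmap_left_basis leg13_basis linear_lin_ext[OF linear_on_tmap],
          rule lin_ext_pair_cong) (simp_all add: tmap_right_cQ_basis[unfolded One_nat_def])
    show "f23 (c1 v) = c1 (f13 v)"
      by (rule tpow3_eqI[OF v linear_on_comp[OF linear_on_tmap linear_on_tmap]
            linear_on_comp[OF linear_on_tmap linear_on_leg]],
          unfold tmap_left_cQ_basis tmap_right_basis leg13_basis linear_lin_ext[OF linear_on_tmap],
          rule lin_ext_pair_cong) simp_all
    show "f13 (c1 v) = c1 (f23 v)"
      by (rule tpow3_eqI[OF v linear_on_comp[OF linear_on_leg linear_on_tmap]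
            linear_on_comp[OF linear_on_tmap linear_on_tmap]],
          unfold tmap_left_cQ_basis tmap_right_basis leg13_basis linear_lin_ext[OF linear_on_tmap],
          rule lin_ext_pair_cong) (simp_all add: tmap_left_cQ_basis)
    show "f13 (c2 v) = c2 (f12 v)"
      by (rule tpow3_eqI[OF v linear_on_comp[OF linear_on_leg linear_on_tmap]
            linear_on_comp[OF linear_on_tmap linear_on_tmap]],
          unfold tmap_right_cQ_basis tmap_left_basis leg13_basis linear_lin_ext[OF linear_on_tmap],
          rule lin_ext_pair_cong) (simp_all add: tmap_right_cQ_basis[unfolded One_nat_def])
  qed
qed

end

section \<open>Entropic deformations and r-matrices\<close>

theorem theorem17:
  fixes Q :: "'q set" and op :: "'q \<Rightarrow> 'q \<Rightarrow> 'q"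
    and \<mm> :: "'a::comm_ring_1 set"
    and f :: "('q list \<Rightarrow>\<^sub>0 'a) \<Rightarrow> ('q list \<Rightarrow>\<^sub>0 'a)"
  assumes ideal: "module.subspace (*) \<mm>"
    and rack: "rack Q op"
    and auto: "automorphism_on (tpow Q 2) f"
    and entropic: "entropic Q (cQ op) 2 f"
    and cong: "cong_id_mod \<mm> (tpow Q 2) f"
  shows "(yang_baxter Q (cQ op \<circ> f) \<longleftrightarrow> yang_baxter Q (transposition \<circ> f)) \<and>
         (yang_baxter Q (transposition \<circ> f) \<longleftrightarrow> r_matrix Q f)"
proof -
  interpret rack Q op by (rule rack)
  interpret pair_map Q f
    using auto by unfold_locales (auto simp: automorphism_on_def dest: bij_betwE)
  interpret rack_pair_map Q op f ..
  have "yang_baxter Q (cQ op \<circ> f) \<longleftrightarrow>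
      (\<forall>v\<in>tpow Q 3. (leg f 1 2 \<circ> leg f 1 3 \<circ> leg f 2 3) v = (leg f 2 3 \<circ> leg f 1 3 \<circ> leg f 1 2) v)"
    by (rule yang_baxter_iff_legs)
      (fact entropic_f12_c2[OF entropic] entropic_f23_c1[OF entropic]
        entropic_f13_c1[OF entropic] entropic_f13_c2[OF entropic])+
  then show ?thesis
    using auto yang_baxter_transposition_iff_legs by (simp add: r_matrix_def)
qed

end
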